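(* Let $\mathcal T_1,\mathcal T,\mathcal T_2$ be monoids, let $(M_1,{M_1}_0)$ be a $(\mathcal T_1,\mathcal T)$-bimodule prepair, $(M_2,{M_2}_0)$ a $(\mathcal T,\mathcal T_2)$-bimodule prepair, and $(M_3,{M_3}_0)$ a $(\mathcal T_1,\mathcal T_2)$-bimodule prepair. Then there is a one-to-one correspondence $$\operatorname{WMor}(M_1\times M_2,M_3)\;\approx\;\operatorname{Mor}_{\mathrm{wk}}\bigl(M_2,\operatorname{Mor}_{\mathrm{wk}}(M_1,M_3)\bigr),$$ sending $f$ to the map $w\mapsto f_w$, where $f_w(v)=f(v,w)$ for $v\in M_1$, $w\in M_2$.
   Context: All monoids are multiplicative with unit $\mathbb 1$. A $(\mathcal T_1,\mathcal T_2)$-bimodule is a commutative monoid $(M,+,0)$ with a left action of $\mathcal T_1$ and a right action of $\mathcal T_2$ that are unital, associative, distributive over $+$, fix $0$, and satisfy $(a_1b)a_2=a_1(ba_2)$. A bimodule prepair $(M,M_0)$ is a bimodule with a sub-bimodule $M_0$ (containing $0$). One-sided module prepairs are defined analogously. A weak morphism of prepairs $(M,M_0)\to(M',M'_0)$ is a map $f:M\to M'$ that commutes with the relevant actions, satisfies $f(0)=0$ and $f(M_0)\subseteq M'_0$, and is such that for every finite family $b_i\in M$ with $\sum b_i\in M_0$ one has $\sum f(b_i)\in M'_0$. It need not be additive. $\operatorname{Mor}_{\mathrm{wk}}(M_1,M_3)$ is the set of weak morphisms $(M_1,{M_1}_0)\to(M_3,{M_3}_0)$ of left $\mathcal T_1$-module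 prepairs. It is regarded as a right $\mathcal T_2$-module prepair with $(f_1+f_2)(v)=f_1(v)+f_2(v)$, $(fa)(v)=f(v)a$ for $a\in\mathcal T_2$, and null part $\operatorname{Mor}_{\mathrm{wk}}(M_1,M_3)_0=\{f: f(M_1)\subseteq {M_3}_0\}$. $\operatorname{Mor}_{\mathrm{wk}}(M_2,\operatorname{Mor}_{\mathrm{wk}}(M_1,M_3))$ is the set of weak morphisms of right $\mathcal T_2$-module prepairs. $\operatorname{WMor}(M_1\times M_2,M_3)$ is the set of maps $f:M_1\times M_2\to M_3$ with $f(a_1v,w)=a_1f(v,w)$ and $f(v,wa_2)=f(v,w)a_2$ for $a_i\in\mathcal T_i$, with $f(0,w)=0=f(v,0)$, and having the following property: whenever $b_j\in M_j$ and $b_{i,j}\in M_i$ (finite families) satisfy $\sum_j b_{i,j}\in{M_i}_0$ for $i=1,2$, then $$f\Bigl(\sum_j b_{1,j},\,b_2\Bigr)\in{M_3}_0\quad\text{and}\quad f\Bigl(b_1,\,\sum_j b_{2,j}\Bigr)\in{M_3}_0 .$$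
   Formalization: In WMor the sums stand outside f: for families with null sums one requires Σ_j f(b_{1,j},b_2) and Σ_j f(b_1,b_{2,j}) in M_{3,0}, instead of f(Σ_j b_{1,j},b_2) and f(b_1,Σ_j b_{2,j}); with the printed condition f_w need not be a weak morphism. *)

theory Defs
  imports "HOL-Library.Function_Algebras"
begin

text \<open>
  Monoids are types of class \<^class>\<open>monoid_mult\<close>, the commutative monoids underlying modules
  are submonoids \<open>M\<close> of types of class \<^class>\<open>comm_monoid_add\<close>. An explicit carrier is needed
  only for \<open>Mor\<^sub>w\<^sub>k(M\<^sub>1, M\<^sub>3)\<close>, which is a proper submonoid of the type of all functions; all
  other modules below occupy a whole type.
\<close>

locale left_module_prepair =
  fixes M :: "'m::comm_monoid_add set"
    and M0 :: "'m set"
    and lact :: "'t::monoid_mult \<Rightarrow> 'm \<Rightarrow> 'm"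
  assumes zero_closed: "0 \<in> M"
    and add_closed: "x \<in> M \<Longrightarrow> y \<in> M \<Longrightarrow> x + y \<in> M"
    and lact_closed: "x \<in> M \<Longrightarrow> lact a x \<in> M"
    and lact_one: "x \<in> M \<Longrightarrow> lact 1 x = x"
    and lact_mult: "x \<in> M \<Longrightarrow> lact (a * b) x = lact a (lact b x)"
    and lact_add: "x \<in> M \<Longrightarrow> y \<in> M \<Longrightarrow> lact a (x + y) = lact a x + lact a y"
    and lact_zero: "lact a 0 = 0"
    and null_subset: "M0 \<subseteq> M"
    and null_zero: "0 \<in> M0"
    and null_add: "x \<in> M0 \<Longrightarrow> y \<in> M0 \<Longrightarrow> x + y \<in> M0"
    and null_lact: "x \<in> M0 \<Longrightarrow> lact a x \<in> M0"

locale right_module_prepair =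
  fixes M :: "'m::comm_monoid_add set"
    and M0 :: "'m set"
    and ract :: "'m \<Rightarrow> 't::monoid_mult \<Rightarrow> 'm"
  assumes zero_closed: "0 \<in> M"
    and add_closed: "x \<in> M \<Longrightarrow> y \<in> M \<Longrightarrow> x + y \<in> M"
    and ract_closed: "x \<in> M \<Longrightarrow> ract x a \<in> M"
    and ract_one: "x \<in> M \<Longrightarrow> ract x 1 = x"
    and ract_mult: "x \<in> M \<Longrightarrow> ract x (a * b) = ract (ract x a) b"
    and ract_add: "x \<in> M \<Longrightarrow> y \<in> M \<Longrightarrow> ract (x + y) a = ract x a + ract y a"
    and ract_zero: "ract 0 a = 0"
    and null_subset: "M0 \<subseteq> M"
    and null_zero: "0 \<in> M0"
    and null_add: "x \<in> M0 \<Longrightarrow> y \<in> M0 \<Longrightarrow> x + y \<in> M0"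
    and null_ract: "x \<in> M0 \<Longrightarrow> ract x a \<in> M0"

locale bimodule_prepair =
  left: left_module_prepair UNIV M0 lact + right: right_module_prepair UNIV M0 ract
  for M0 :: "'m::comm_monoid_add set"
    and lact :: "'t1::monoid_mult \<Rightarrow> 'm \<Rightarrow> 'm"
    and ract :: "'m \<Rightarrow> 't2::monoid_mult \<Rightarrow> 'm" +
  assumes lact_ract: "ract (lact a1 x) a2 = lact a1 (ract x a2)"

text \<open>
  The part of the definition of a weak morphism that does not involve the actions. Finite
  families are indexed by \<open>{..<n}\<close>.
\<close>

definition weakly_additive ::
    "'m::comm_monoid_add set \<Rightarrow> 'n::comm_monoid_add set \<Rightarrow> ('m \<Rightarrow> 'n) \<Rightarrow> bool" where
  "weakly_additive M0 N0 f \<longleftrightarrow>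
     f 0 = 0 \<and> f ` M0 \<subseteq> N0 \<and>
     (\<forall>(n::nat) b. (\<Sum>i<n. b i) \<in> M0 \<longrightarrow> (\<Sum>i<n. f (b i)) \<in> N0)"

definition Mor_wk_left ::
    "'m::comm_monoid_add set \<Rightarrow> ('t::monoid_mult \<Rightarrow> 'm \<Rightarrow> 'm) \<Rightarrow>
     'n::comm_monoid_add set \<Rightarrow> ('t \<Rightarrow> 'n \<Rightarrow> 'n) \<Rightarrow> ('m \<Rightarrow> 'n) set" where
  "Mor_wk_left M0 lact N0 lact' =
     {f. (\<forall>a v. f (lact a v) = lact' a (f v)) \<and> weakly_additive M0 N0 f}"

text \<open>
  The first two arguments describe the domain (a whole type), the last three the codomain,
  whose carrier is \<open>N\<close>.
\<close>

definition Mor_wk_right ::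
    "'m::comm_monoid_add set \<Rightarrow> ('m \<Rightarrow> 't::monoid_mult \<Rightarrow> 'm) \<Rightarrow>
     'n::comm_monoid_add set \<Rightarrow> 'n set \<Rightarrow> ('n \<Rightarrow> 't \<Rightarrow> 'n) \<Rightarrow> ('m \<Rightarrow> 'n) set" where
  "Mor_wk_right M0 ract N N0 ract' =
     {f. range f \<subseteq> N \<and> (\<forall>v a. f (ract v a) = ract' (f v) a) \<and> weakly_additive M0 N0 f}"

text \<open>
  The right module prepair structure on \<open>Mor_wk_left M0 lact N0 lact'\<close>. Addition and zero are
  the pointwise ones that \<^theory>\<open>HOL-Library.Function_Algebras\<close> puts on the function type.
\<close>

definition Mor_wk_null ::
    "'m::comm_monoid_add set \<Rightarrow> ('t::monoid_mult \<Rightarrow> 'm \<Rightarrow> 'm) \<Rightarrow>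
     'n::comm_monoid_add set \<Rightarrow> ('t \<Rightarrow> 'n \<Rightarrow> 'n) \<Rightarrow> ('m \<Rightarrow> 'n) set" where
  "Mor_wk_null M0 lact N0 lact' = {f \<in> Mor_wk_left M0 lact N0 lact'. range f \<subseteq> N0}"

definition Mor_wk_ract :: "('n \<Rightarrow> 't2 \<Rightarrow> 'n) \<Rightarrow> ('m \<Rightarrow> 'n) \<Rightarrow> 't2 \<Rightarrow> ('m \<Rightarrow> 'n)" where
  "Mor_wk_ract ract' f a = (\<lambda>v. ract' (f v) a)"

lemma sum_fun_apply: "(\<Sum>i\<in>A. f i) x = (\<Sum>i\<in>A. f i x)"
  for f :: "'i \<Rightarrow> 'a \<Rightarrow> 'b::comm_monoid_add"
  by (induction A rule: infinite_finite_induct) auto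

lemma right_module_prepair_Mor_wk:
  assumes "bimodule_prepair N0 lact' ract'"
  shows "right_module_prepair (Mor_wk_left M0 lact N0 lact')
           (Mor_wk_null M0 lact N0 lact') (Mor_wk_ract ract')"
proof -
  interpret bimodule_prepair N0 lact' ract' by fact
  have sum_ract: "(\<Sum>i<n. ract' (f i) a) = ract' (\<Sum>i<n. f i) a" for n :: nat and f a
    by (induction n) (auto simp: right.ract_zero right.ract_add)
  note defs = Mor_wk_left_def Mor_wk_null_def Mor_wk_ract_def weakly_additive_def image_subset_iff
  show ?thesis
    by unfold_locales
      (auto simp: defs fun_eq_iff left.lact_zero left.null_zero left.lact_add right.ract_one
         right.ract_mult right.ract_add right.ract_zero lact_ract sum.distrib sum_ract
         intro: left.null_add right.null_ract)
qed

text \<open>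
  Maps are not additive here, so for a family with null sum the requirement on
  \<open>f(\<Sum>\<^sub>j b\<^bsub>1,j\<^esub>, b\<^sub>2)\<close> and the one on \<open>\<Sum>\<^sub>j f(b\<^bsub>1,j\<^esub>, b\<^sub>2)\<close> differ. The source
  writes the former; the latter is required here, which makes \<open>f\<close> a weak morphism in each
  argument and implies the former (lemma \<open>WMor_null\<close>). With the former alone, \<open>f(\<cdot>, w)\<close> need not be a weak morphism: for
  \<open>M\<^sub>1 = M\<^sub>2 = \<nat>\<close>, \<open>M\<^sub>3 = \<int>\<close>, null parts \<open>\<nat> - {1}\<close>, \<open>{0}\<close>, \<open>{0}\<close>, trivial monoids, and
  \<open>f(v, w) = (if v = 1 then w else 0)\<close>, the sum \<open>1 + 1\<close> is null but \<open>f(1, 1) + f(1, 1) = 2\<close> is not.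
\<close>

definition WMor ::
    "'m1::comm_monoid_add set \<Rightarrow> ('t1::monoid_mult \<Rightarrow> 'm1 \<Rightarrow> 'm1) \<Rightarrow>
     'm2::comm_monoid_add set \<Rightarrow> ('m2 \<Rightarrow> 't2::monoid_mult \<Rightarrow> 'm2) \<Rightarrow>
     'm3::comm_monoid_add set \<Rightarrow> ('t1 \<Rightarrow> 'm3 \<Rightarrow> 'm3) \<Rightarrow> ('m3 \<Rightarrow> 't2 \<Rightarrow> 'm3) \<Rightarrow>
     ('m1 \<times> 'm2 \<Rightarrow> 'm3) set" where
  "WMor M10 lact1 M20 ract2 M30 lact3 ract3 =
     {f. (\<forall>a v w. f (lact1 a v, w) = lact3 a (f (v, w))) \<and>
         (\<forall>v w a. f (v, ract2 w a) = ract3 (f (v, w)) a) \<and>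
         (\<forall>w. f (0, w) = 0) \<and> (\<forall>v. f (v, 0) = 0) \<and>
         (\<forall>(n1::nat) (n2::nat) c1 c2 b1 b2.
            (\<Sum>j<n1. c1 j) \<in> M10 \<longrightarrow> (\<Sum>j<n2. c2 j) \<in> M20 \<longrightarrow>
            (\<Sum>j<n1. f (c1 j, b2)) \<in> M30 \<and> (\<Sum>j<n2. f (b1, c2 j)) \<in> M30)}"

lemma WMor_null:
  assumes "f \<in> WMor M10 lact1 M20 ract2 M30 lact3 ract3"
    and "(\<Sum>j<n1. c1 j) \<in> M10" and "(\<Sum>j<n2. c2 j) \<in> M20"
  shows "f (\<Sum>j<n1. c1 j, b2) \<in> M30 \<and> f (b1, \<Sum>j<n2. c2 j) \<in> M30"
proof -
  have *: "(\<Sum>j<k. f (d j, b2)) \<in> M30 \<and> (\<Sum>j<l. f (b1, e j)) \<in> M30"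
    if "(\<Sum>j<k. d j) \<in> M10" "(\<Sum>j<l. e j) \<in> M20" for k l :: nat and d e
    using assms(1) that unfolding WMor_def by blast
  from *[where k = 1 and d = "\<lambda>_. \<Sum>j<n1. c1 j" and l = 1 and e = "\<lambda>_. \<Sum>j<n2. c2 j"]
  show ?thesis using assms(2,3) by simp
qed

end

theory Submission
  imports Defs
begin

text \<open>
  Both sides describe the maps that are weak morphisms in each argument separately. For \<open>WMor\<close>,
  the joint condition on two families splits into one condition per argument because the empty
  family has null sum. For iterated weak morphisms, a finite sum of weak morphisms is again a weak
  morphism, so being null is a pointwise condition.
\<close>

lemma weakly_additive_iff:
  "weakly_additive M0 N0 f \<longleftrightarrow>
     f 0 = 0 \<and> (\<forall>(n::nat) b. (\<Sum>i<n. b i) \<in> M0 \<longrightarrow> (\<Sum>i<n. f (b i)) \<in> N0)"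
proof -
  have "f x \<in> N0"
    if "\<forall>(n::nat) b. (\<Sum>i<n. b i) \<in> M0 \<longrightarrow> (\<Sum>i<n. f (b i)) \<in> N0" "x \<in> M0" for x
    using that(1)[rule_format, of "\<lambda>_. x" 1] that(2) by simp
  then show ?thesis
    unfolding weakly_additive_def by blast
qed

text \<open>Needed for the module of weak morphisms, whose carrier is not a whole type.\<close>

lemma (in right_module_prepair) sum_closed:
  "(\<And>i. i \<in> A \<Longrightarrow> f i \<in> M) \<Longrightarrow> (\<Sum>i\<in>A. f i) \<in> M"
  by (induction A rule: infinite_finite_induct) (auto simp: zero_closed add_closed)

lemma WMor_iff:
  assumes "0 \<in> M10" and "0 \<in> M20"
  shows "f \<in> WMor M10 lact1 M20 ract2 M30 lact3 ract3 \<longleftrightarrow>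
     (\<forall>w. (\<lambda>v. f (v, w)) \<in> Mor_wk_left M10 lact1 M30 lact3) \<and>
     (\<forall>v w a. f (v, ract2 w a) = ract3 (f (v, w)) a) \<and>
     (\<forall>v. weakly_additive M20 M30 (\<lambda>w. f (v, w)))"
proof -
  have "(\<forall>(n1::nat) (n2::nat) c1 c2 b1 b2.
            (\<Sum>j<n1. c1 j) \<in> M10 \<longrightarrow> (\<Sum>j<n2. c2 j) \<in> M20 \<longrightarrow>
            (\<Sum>j<n1. f (c1 j, b2)) \<in> M30 \<and> (\<Sum>j<n2. f (b1, c2 j)) \<in> M30) \<longleftrightarrow>
     (\<forall>w (n::nat) c. (\<Sum>j<n. c j) \<in> M10 \<longrightarrow> (\<Sum>j<n. f (c j, w)) \<in> M30) \<and>
     (\<forall>v (n::nat) c. (\<Sum>j<n. c j) \<in> M20 \<longrightarrow> (\<Sum>j<n. f (v, c j)) \<in> M30)"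
    (is "?joint \<longleftrightarrow> ?separate")
  proof
    assume joint: ?joint
    have "(\<Sum>j<n. f (c j, w)) \<in> M30" if "(\<Sum>j<n. c j) \<in> M10" for w c and n :: nat
      \<comment> \<open>The last \<open>0\<close> is the length of the second family: it is empty,
        so its entries are arbitrary and its sum 0 is null.\<close>
      using joint[rule_format, of c n "\<lambda>_. 0" 0] that assms(2) by simp
    moreover have "(\<Sum>j<n. f (v, c j)) \<in> M30" if "(\<Sum>j<n. c j) \<in> M20" for v c and n :: nat
      using joint[rule_format, of "\<lambda>_. 0" 0 c n] that assms(1) by simp
    ultimately show ?separate by blast
  qed blast
  then show ?thesis
    by (simp only: WMor_def Mor_wk_left_def weakly_additive_iff mem_Collect_eq all_conj_distrib) auto
qed

text \<open>Evaluation at \<open>v\<close> turns equations and null sums of functions into pointwise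
  ones. The result has the shape of \<open>WMor_iff\<close>, with \<open>g w v\<close> in place of
  \<open>f (v, w)\<close>.\<close>

lemma Mor_wk_right_Mor_wk_iff:
  assumes "bimodule_prepair N0 lact' ract'"
  shows "g \<in> Mor_wk_right L0 ractL (Mor_wk_left M0 lact N0 lact') (Mor_wk_null M0 lact N0 lact')
           (Mor_wk_ract ract') \<longleftrightarrow>
     (\<forall>w. g w \<in> Mor_wk_left M0 lact N0 lact') \<and>
     (\<forall>v w a. g (ractL w a) v = ract' (g w v) a) \<and>
     (\<forall>v. weakly_additive L0 N0 (\<lambda>w. g w v))"
proof -
  interpret Mor: right_module_prepair "Mor_wk_left M0 lact N0 lact'"
      "Mor_wk_null M0 lact N0 lact'" "Mor_wk_ract ract'"
    using assms by (rule right_module_prepair_Mor_wk)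
  \<comment> \<open>A null element must itself be a weak morphism; closure under sums supplies this,
    leaving only the condition on values.\<close>
  have "(\<Sum>i<n. g (b i)) \<in> Mor_wk_null M0 lact N0 lact' \<longleftrightarrow> (\<forall>v. (\<Sum>i<n. g (b i) v) \<in> N0)"
    if "\<forall>w. g w \<in> Mor_wk_left M0 lact N0 lact'" for b and n :: nat
    using Mor.sum_closed[of "{..<n}" "\<lambda>i. g (b i)"] that
    by (auto simp: Mor_wk_null_def sum_fun_apply image_subset_iff)
  then show ?thesis
    by (auto simp: Mor_wk_right_def weakly_additive_iff Mor_wk_ract_def image_subset_iff fun_eq_iff)
qed

theorem theorem5p13:
  fixes M10 :: "'m1::comm_monoid_add set"
    and lact1 :: "'t1::monoid_mult \<Rightarrow> 'm1 \<Rightarrow> 'm1"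
    and ract1 :: "'m1 \<Rightarrow> 't::monoid_mult \<Rightarrow> 'm1"
    and M20 :: "'m2::comm_monoid_add set"
    and lact2 :: "'t \<Rightarrow> 'm2 \<Rightarrow> 'm2"
    and ract2 :: "'m2 \<Rightarrow> 't2::monoid_mult \<Rightarrow> 'm2"
    and M30 :: "'m3::comm_monoid_add set"
    and lact3 :: "'t1 \<Rightarrow> 'm3 \<Rightarrow> 'm3"
    and ract3 :: "'m3 \<Rightarrow> 't2 \<Rightarrow> 'm3"
  assumes "bimodule_prepair M10 lact1 ract1"
    and "bimodule_prepair M20 lact2 ract2"
    and "bimodule_prepair M30 lact3 ract3"
  shows "bij_betw (\<lambda>f w v. f (v, w))
           (WMor M10 lact1 M20 ract2 M30 lact3 ract3)
           (Mor_wk_right M20 ract2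
              (Mor_wk_left M10 lact1 M30 lact3)
              (Mor_wk_null M10 lact1 M30 lact3)
              (Mor_wk_ract ract3))"
\<comment> \<open>The inverse uncurries and swaps the arguments back.\<close>
proof (rule bij_betw_byWitness[where f' = "\<lambda>g (v, w). g w v"])
  have null_zero: "0 \<in> M10" "0 \<in> M20"
    using assms(1,2) by (auto simp: bimodule_prepair_def left_module_prepair_def)
  \<comment> \<open>Under currying the two characterizations become the same three conditions, so
    both inclusions follow by rewriting.\<close>
  note iffs = WMor_iff[OF null_zero] Mor_wk_right_Mor_wk_iff[OF assms(3)]
  show "(\<lambda>f w v. f (v, w)) ` WMor M10 lact1 M20 ract2 M30 lact3 ract3 \<subseteq>
      Mor_wk_right M20 ract2 (Mor_wk_left M10 lact1 M30 lact3)
        (Mor_wk_null M10 lact1 M30 lact3) (Mor_wk_ract ract3)"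
    by (auto simp: iffs)
  show "(\<lambda>g (v, w). g w v) `
      Mor_wk_right M20 ract2 (Mor_wk_left M10 lact1 M30 lact3)
        (Mor_wk_null M10 lact1 M30 lact3) (Mor_wk_ract ract3) \<subseteq>
      WMor M10 lact1 M20 ract2 M30 lact3 ract3"
    by (auto simp: iffs)
qed auto

end
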